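(* Let $A\subseteq\mathcal V$ be such that $K:=K(U(A))<\infty$. Then for every $\delta>0$, $$\mathbb P\big[\operatorname{RIP}_A(\delta)\big]\ \ge\ 1-2\,\nu_{\|\cdot\|_{w,\infty}}\!\Big(U(A),\tfrac14\tfrac{\delta}{\sqrt K}\Big)\exp\!\Big(-\tfrac n2\big(\tfrac{\delta}{K}\big)^2\Big).$$
   Context: $Y\subseteq\mathbb R^d$ is a Borel set, $\rho$ a probability measure on $Y$, and $\mathcal V$ a Banach space of functions with norm $\|v\|=\big(\int_Y|v|_y^2\,d\rho(y)\big)^{1/2}$, where for each $y\in Y$, $|\cdot|_y$ is a seminorm on $\mathcal V$, and for each $v\in\mathcal V$ the map $y\mapsto|v|_y$ is measurable and the integral is finite. A weight function $w\ge0$ on $Y$ with $\int_Y w^{-1}\,d\rho=1$ is fixed. The points $y_1,\dots,y_n$ are i.i.d. with distribution $w^{-1}\rho$, and $\|v\|_n:=\big(\frac1n\sum_{i=1}^n w(y_i)|v|_{y_i}^2\big)^{1/2}$. Put $\|v\|_{w,\infty}^2:=\operatorname{ess\,sup}_{y\in Y}w(y)|v|_y^2$ (essential supremum with respect to $\rho$; the value $\infty$ is allowed) and, for $B\subseteq\mathcal V$, $K(B):=\sup_{u\in B}\|u\|_{w,\infty}^2$. Standing convention: almost surely, $\|v\|_n\le\|v\|_{w,\infty}$ holds simultaneously for all $v\in\mathcal V$. Events whose probability is taken are understood to be measurable. $U(A):=\{u/\|u\|: u\in A\setminus\{0\}\}$, and $A$ is understood to contain a non-zero element. $\operatorname{RIP}_A(\delta)$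 is the event that $(1-\delta)\|u\|^2\le\|u\|_n^2\le(1+\delta)\|u\|^2$ for all $u\in A$. The covering number $\nu_{\|\cdot\|_{w,\infty}}(B,\varepsilon)$ is the minimal number of open $\|\cdot\|_{w,\infty}$-balls of radius $\varepsilon$ with centres in $B$ needed to cover $B$ (possibly $\infty$, in which case the bound is trivial). *)

theory Defs
  imports "HOL-Probability.Probability"
begin

definition is_seminorm :: "('v::real_vector \<Rightarrow> real) \<Rightarrow> bool" where
  "is_seminorm p \<longleftrightarrow>
     (\<forall>v. 0 \<le> p v) \<and> (\<forall>u v. p (u + v) \<le> p u + p v) \<and> (\<forall>c v. p (c *\<^sub>R v) = \<bar>c\<bar> * p v)"

text \<open>Throughout, \<open>s y v\<close> stands for the local seminorm \<open>|v|_y\<close>.\<close>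

text \<open>The measure \<open>w\<^sup>-\<^sup>1 \<rho>\<close>. The inverse is taken in \<open>ennreal\<close>, where \<open>inverse 0 = \<infinity>\<close>;
  the real-valued \<open>inverse (w y)\<close> would be 0 wherever \<open>w\<close> vanishes.\<close>

definition sampling_measure :: "'a measure \<Rightarrow> ('a \<Rightarrow> real) \<Rightarrow> 'a measure" where
  "sampling_measure \<rho> w = density \<rho> (\<lambda>y. inverse (ennreal (w y)))"

definition emp_norm ::
    "('a \<Rightarrow> real) \<Rightarrow> ('a \<Rightarrow> 'v \<Rightarrow> real) \<Rightarrow> nat \<Rightarrow> (nat \<Rightarrow> 'a) \<Rightarrow> 'v \<Rightarrow> real" where
  "emp_norm w s n y v = sqrt ((1 / real n) * (\<Sum>i = 1..n. w (y i) * (s (y i) v)\<^sup>2))"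

definition wsup_norm_sq ::
    "'a measure \<Rightarrow> ('a \<Rightarrow> real) \<Rightarrow> ('a \<Rightarrow> 'v \<Rightarrow> real) \<Rightarrow> 'v \<Rightarrow> ereal" where
  "wsup_norm_sq \<rho> w s v = esssup \<rho> (\<lambda>y. ereal (w y * (s y v)\<^sup>2))"

definition wsup_norm ::
    "'a measure \<Rightarrow> ('a \<Rightarrow> real) \<Rightarrow> ('a \<Rightarrow> 'v \<Rightarrow> real) \<Rightarrow> 'v \<Rightarrow> ereal" where
  "wsup_norm \<rho> w s v =
     (if wsup_norm_sq \<rho> w s v = \<infinity> then \<infinity>
      else ereal (sqrt (real_of_ereal (wsup_norm_sq \<rho> w s v))))"

definition variation_const ::
    "'a measure \<Rightarrow> ('a \<Rightarrow> real) \<Rightarrow> ('a \<Rightarrow> 'v \<Rightarrow> real) \<Rightarrow> 'v set \<Rightarrow> ereal" where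
  "variation_const \<rho> w s B = (SUP u\<in>B. wsup_norm_sq \<rho> w s u)"

definition normalized :: "'v::real_normed_vector set \<Rightarrow> 'v set" where
  "normalized A = (\<lambda>u. u /\<^sub>R norm u) ` (A - {0})"

definition RIP ::
    "('a \<Rightarrow> real) \<Rightarrow> ('a \<Rightarrow> 'v \<Rightarrow> real) \<Rightarrow> nat \<Rightarrow> (nat \<Rightarrow> 'a) \<Rightarrow> 'v::real_normed_vector set \<Rightarrow> real \<Rightarrow> bool"
  where
  "RIP w s n y A \<delta> \<longleftrightarrow>
     (\<forall>u\<in>A. (1 - \<delta>) * (norm u)\<^sup>2 \<le> (emp_norm w s n y u)\<^sup>2 \<and>
            (emp_norm w s n y u)\<^sup>2 \<le> (1 + \<delta>) * (norm u)\<^sup>2)"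

text \<open>Covering number with respect to an extended-valued norm \<open>N\<close>; the value is \<open>\<infinity>\<close>
  (the infimum of the empty set) if no finite cover exists.\<close>

definition covering_number :: "('v::ab_group_add \<Rightarrow> ereal) \<Rightarrow> 'v set \<Rightarrow> real \<Rightarrow> enat" where
  "covering_number N B \<epsilon> =
     (INF C\<in>{C. finite C \<and> C \<subseteq> B \<and> B \<subseteq> (\<Union>c\<in>C. {v. N (v - c) < ereal \<epsilon>})}. enat (card C))"

end

theory Submission
  imports Defs
begin

text \<open>For a unit vector \<open>u\<close>, the squared empirical norm is an average of i.i.d. variables
  with values in \<open>[0, K]\<close> and mean 1, so Hoeffding's inequality with deviation
  \<open>\<delta> / 2\<close> gives the factor \<open>2 exp (- (n / 2) (\<delta> / K)\<^sup>2)\<close>. A union bound covers the centres of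
  an optimal net of radius \<open>\<delta> / (4 \<surd>K)\<close>. For any other \<open>u\<close> with nearby centre \<open>c\<close>, the
  squared empirical norms differ by at most
  \<open>\<parallel>u - c\<parallel>\<^sub>n (\<parallel>u\<parallel>\<^sub>n + \<parallel>c\<parallel>\<^sub>n) \<le> \<delta> / (4 \<surd>K) * 2 \<surd>K = \<delta> / 2\<close>.\<close>

section \<open>The empirical norm for a fixed sample\<close>

lemma emp_norm_nonneg:
  assumes "\<And>i. i \<in> {1..n} \<Longrightarrow> 0 \<le> w (x i)"
  shows "0 \<le> emp_norm w s n x v"
  unfolding emp_norm_def
  by (intro real_sqrt_ge_zero mult_nonneg_nonneg sum_nonneg assms) auto

lemma emp_norm_sq:
  assumes "\<And>i. i \<in> {1..n} \<Longrightarrow> 0 \<le> w (x i)"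
  shows "(emp_norm w s n x v)\<^sup>2 = (\<Sum>i = 1..n. w (x i) * (s (x i) v)\<^sup>2) / real n"
proof -
  have "0 \<le> (1 / real n) * (\<Sum>i = 1..n. w (x i) * (s (x i) v)\<^sup>2)"
    by (intro mult_nonneg_nonneg sum_nonneg assms) auto
  then show ?thesis
    unfolding emp_norm_def by simp
qed

text \<open>Absorbing the weights into the coordinates turns the empirical norm into a Euclidean
  norm, so that Minkowski's inequality applies.\<close>

lemma emp_norm_eq_L2_set:
  assumes "\<And>i. i \<in> {1..n} \<Longrightarrow> 0 \<le> w (x i)"
  shows "emp_norm w s n x v = L2_set (\<lambda>i. sqrt (w (x i) / real n) * s (x i) v) {1..n}"
  unfolding emp_norm_def L2_set_def using assms
  by (simp add: sum_distrib_left power_mult_distrib)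

lemma is_seminorm_scaleR: "is_seminorm p \<Longrightarrow> p (c *\<^sub>R v) = \<bar>c\<bar> * p v"
  by (simp add: is_seminorm_def)

lemma is_seminorm_minus: "is_seminorm p \<Longrightarrow> p (- v) = p v"
  using is_seminorm_scaleR[of p "-1" v] by simp

lemma is_seminorm_zero: "is_seminorm p \<Longrightarrow> p 0 = 0"
  using is_seminorm_scaleR[of p 0 0] by simp

text \<open>Used twice below: subadditivity compares a vector with its net centre, and homogeneity
  reduces \<open>A\<close> to unit vectors.\<close>

lemma is_seminorm_emp_norm:
  assumes w: "\<And>i. i \<in> {1..n} \<Longrightarrow> 0 \<le> w (x i)"
    and s: "\<And>i. i \<in> {1..n} \<Longrightarrow> is_seminorm (s (x i))"
  shows "is_seminorm (emp_norm w s n x)"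
  unfolding is_seminorm_def
proof (intro conjI allI)
  show "0 \<le> emp_norm w s n x v" for v
    by (rule emp_norm_nonneg) (use w in auto)
next
  fix u v
  let ?r = "\<lambda>i. sqrt (w (x i) / real n)"
  have "emp_norm w s n x (u + v) = L2_set (\<lambda>i. ?r i * s (x i) (u + v)) {1..n}"
    by (rule emp_norm_eq_L2_set) (use w in auto)
  also have "\<dots> \<le> L2_set (\<lambda>i. ?r i * s (x i) u + ?r i * s (x i) v) {1..n}"
  proof (rule L2_set_mono)
    fix i assume i: "i \<in> {1..n}"
    show "?r i * s (x i) (u + v) \<le> ?r i * s (x i) u + ?r i * s (x i) v"
      using s[OF i] w[OF i] unfolding is_seminorm_def
      by (simp flip: distrib_left add: mult_left_mono)
    show "0 \<le> ?r i * s (x i) (u + v)"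
      using s[OF i] w[OF i] unfolding is_seminorm_def by simp
  qed
  also have "\<dots> \<le> L2_set (\<lambda>i. ?r i * s (x i) u) {1..n} + L2_set (\<lambda>i. ?r i * s (x i) v) {1..n}"
    by (rule L2_set_triangle_ineq)
  also have "\<dots> = emp_norm w s n x u + emp_norm w s n x v"
    using emp_norm_eq_L2_set[of n w x s, OF w] by presburger
  finally show "emp_norm w s n x (u + v) \<le> emp_norm w s n x u + emp_norm w s n x v" .
next
  fix c v
  have "(\<Sum>i = 1..n. w (x i) * (s (x i) (c *\<^sub>R v))\<^sup>2)
      = c\<^sup>2 * (\<Sum>i = 1..n. w (x i) * (s (x i) v)\<^sup>2)"
    unfolding sum_distrib_left
    by (intro sum.cong refl) (simp add: is_seminorm_scaleR[OF s] power_mult_distrib)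
  then have "emp_norm w s n x (c *\<^sub>R v)
      = sqrt (c\<^sup>2 * ((1 / real n) * (\<Sum>i = 1..n. w (x i) * (s (x i) v)\<^sup>2)))"
    by (simp add: emp_norm_def)
  then show "emp_norm w s n x (c *\<^sub>R v) = \<bar>c\<bar> * emp_norm w s n x v"
    by (simp only: emp_norm_def real_sqrt_mult real_sqrt_abs)
qed

text \<open>Factor the difference of squares: the reverse triangle inequality bounds one factor by
  \<open>e\<close>, and the other is at most \<open>2 * b\<close>. Later \<open>e\<close> is the net
  radius and \<open>b\<close> is \<open>sqrt K\<close>.\<close>

lemma is_seminorm_diff_sq_le:
  assumes p: "is_seminorm p" and u: "p u \<le> b" and v: "p v \<le> b" and d: "p (u - v) \<le> e"
  shows "\<bar>(p u)\<^sup>2 - (p v)\<^sup>2\<bar> \<le> e * (2 * b)"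
proof -
  have tri: "p (a + b) \<le> p a + p b" and nn: "0 \<le> p a" for a b
    using p by (auto simp: is_seminorm_def)
  have "p u \<le> p (u - v) + p v" "p v \<le> p (v - u) + p u"
    using tri[of "u - v" v] tri[of "v - u" u] by auto
  moreover have "p (v - u) = p (u - v)"
    using is_seminorm_minus[OF p, of "u - v"] by simp
  ultimately have "\<bar>p u - p v\<bar> \<le> e" using d by linarith
  moreover have "\<bar>p u + p v\<bar> \<le> 2 * b" using u v nn[of u] nn[of v] by linarith
  moreover have "0 \<le> e" using nn[of "u - v"] d by linarith
  ultimately have "\<bar>p u - p v\<bar> * \<bar>p u + p v\<bar> \<le> e * (2 * b)"
    by (intro mult_mono) auto
  moreover have "(p u)\<^sup>2 - (p v)\<^sup>2 = (p u - p v) * (p u + p v)"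
    by (simp add: power2_eq_square algebra_simps)
  ultimately show ?thesis by (simp add: abs_mult)
qed

text \<open>Both sides of the RIP inequalities are homogeneous of degree 2, so only unit vectors
  matter; at 0 both sides vanish.\<close>

lemma RIP_normalizedI:
  assumes p: "is_seminorm (emp_norm w s n x)"
    and u: "\<And>u. u \<in> normalized A \<Longrightarrow> \<bar>(emp_norm w s n x u)\<^sup>2 - 1\<bar> \<le> \<delta>"
  shows "RIP w s n x A \<delta>"
  unfolding RIP_def
proof
  fix v assume "v \<in> A"
  let ?p = "emp_norm w s n x"
  show "(1 - \<delta>) * (norm v)\<^sup>2 \<le> (?p v)\<^sup>2 \<and> (?p v)\<^sup>2 \<le> (1 + \<delta>) * (norm v)\<^sup>2"
  proof (cases "v = 0")
    case True
    then show ?thesis by (simp add: is_seminorm_zero[OF p])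
  next
    case False
    let ?u = "v /\<^sub>R norm v"
    have "?u \<in> normalized A" using \<open>v \<in> A\<close> False by (auto simp: normalized_def)
    from u[OF this] have "1 - \<delta> \<le> (?p ?u)\<^sup>2" "(?p ?u)\<^sup>2 \<le> 1 + \<delta>" by auto
    then have "(1 - \<delta>) * (norm v)\<^sup>2 \<le> (?p ?u)\<^sup>2 * (norm v)\<^sup>2"
      and "(?p ?u)\<^sup>2 * (norm v)\<^sup>2 \<le> (1 + \<delta>) * (norm v)\<^sup>2"
      by (auto intro: mult_right_mono)
    moreover have "(?p ?u)\<^sup>2 * (norm v)\<^sup>2 = (?p v)\<^sup>2"
      using False by (simp add: is_seminorm_scaleR[OF p] field_simps)
    ultimately show ?thesis by simp
  qed
qed

section \<open>Weighted supremum norm, unit vectors and optimal nets\<close>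

lemma wsup_norm_le_sqrt:
  assumes "wsup_norm_sq \<rho> w s v \<le> ereal K" and "0 \<le> K"
  shows "wsup_norm \<rho> w s v \<le> ereal (sqrt K)"
  \<comment> \<open>At the value -\<infinity>, \<open>real_of_ereal\<close> returns 0 and
    \<open>0 \<le> K\<close> settles the claim; the value \<infinity> contradicts the bound.\<close>
  using assms by (cases "wsup_norm_sq \<rho> w s v") (auto simp: wsup_norm_def)

lemma norm_normalized: "u \<in> normalized A \<Longrightarrow> norm u = 1"
  unfolding normalized_def by auto (metis left_inverse norm_eq_zero)

text \<open>A finite infimum comes from a nonempty set of natural numbers, so it is attained by some
  net.\<close>

lemma covering_number_eqE:
  assumes "covering_number N B e = enat k"
  obtains C where "finite C" "C \<subseteq> B" "B \<subseteq> (\<Union>c\<in>C. {v. N (v - c) < ereal e})" "card C = k"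
proof -
  let ?S = "{C. finite C \<and> C \<subseteq> B \<and> B \<subseteq> (\<Union>c\<in>C. {v. N (v - c) < ereal e})}"
  have eq: "Inf ((\<lambda>C. enat (card C)) ` ?S) = enat k"
    using assms unfolding covering_number_def .
  have "?S \<noteq> {}"
  proof
    assume "?S = {}"
    then have "Inf ((\<lambda>C. enat (card C)) ` ?S) = \<infinity>"
      by (simp only: image_empty Inf_enat_def simp_thms if_True)
    with eq show False by simp
  qed
  then have "Inf ((\<lambda>C. enat (card C)) ` ?S) \<in> (\<lambda>C. enat (card C)) ` ?S"
    by (auto simp: Inf_enat_def intro: LeastI)
  with eq show ?thesis using that by auto
qed

section \<open>The sampling measure and concentration under it\<close>

lemma AE_weight_pos:
  assumes w: "w \<in> borel_measurable \<rho>"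
    and fin: "(\<integral>\<^sup>+ x. inverse (ennreal (w x)) \<partial>\<rho>) \<noteq> \<infinity>"
  shows "AE x in \<rho>. 0 < w x"
proof -
  \<comment> \<open>The \<open>ennreal\<close> inverse is \<infinity> wherever \<open>w\<close> is
    zero or negative; a finite integral confines this to a null set.\<close>
  have "AE x in \<rho>. inverse (ennreal (w x)) \<noteq> \<infinity>"
    by (rule nn_integral_PInf_AE) (use w fin in auto)
  then show ?thesis
  proof eventually_elim
    case (elim x)
    then have "ennreal (w x) \<noteq> 0" by auto
    then show ?case by (metis ennreal_neg linorder_not_le)
  qed
qed

text \<open>Gives a real-valued density, the form in which Bochner integrals can be
  transformed.\<close>

lemma sampling_measure_eq_density:
  assumes w: "w \<in> borel_measurable \<rho>" and pos: "AE x in \<rho>. 0 < w x"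
  shows "sampling_measure \<rho> w = density \<rho> (\<lambda>x. ennreal (inverse (w x)))"
  unfolding sampling_measure_def
proof (rule density_cong)
  show "AE x in \<rho>. inverse (ennreal (w x)) = ennreal (inverse (w x))"
    using pos by eventually_elim (simp add: inverse_ennreal)
qed (use w in auto)

text \<open>The weight cancels the density almost everywhere. With \<open>f\<close> the squared
  local seminorm this yields mean 1 for unit vectors.\<close>

lemma integral_sampling_measure:
  fixes f :: "'a \<Rightarrow> real"
  assumes w: "w \<in> borel_measurable \<rho>" and pos: "AE x in \<rho>. 0 < w x"
    and f: "f \<in> borel_measurable \<rho>"
  shows "(\<integral>x. w x * f x \<partial>sampling_measure \<rho> w) = (\<integral>x. f x \<partial>\<rho>)"
proof -
  have "(\<integral>x. w x * f x \<partial>sampling_measure \<rho> w) = (\<integral>x. inverse (w x) *\<^sub>R (w x * f x) \<partial>\<rho>)"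
    unfolding sampling_measure_eq_density[OF w pos]
  proof (rule integral_density)
    show "AE x in \<rho>. 0 \<le> inverse (w x)" using pos by eventually_elim simp
  qed (use w f in auto)
  also have "\<dots> = (\<integral>x. f x \<partial>\<rho>)"
  proof (rule integral_cong_AE)
    show "AE x in \<rho>. inverse (w x) *\<^sub>R (w x * f x) = f x"
      using pos by eventually_elim simp
  qed (use w f in auto)
  finally show ?thesis .
qed

text \<open>Composing with \<open>g\<close> preserves independence and equal laws, while the almost
  sure bound and the mean transfer from the common law \<open>S\<close> to each sample.\<close>

lemma Hoeffding_iid_sample:
  fixes g :: "'a \<Rightarrow> real" and y :: "nat \<Rightarrow> 'b \<Rightarrow> 'a"
  assumes M: "prob_space M"
    and n: "1 \<le> n"
    and indep: "prob_space.indep_vars M (\<lambda>_. N) y {1..n}"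
    and ident: "\<And>i. i \<in> {1..n} \<Longrightarrow> distr M N (y i) = S"
    and g: "g \<in> borel_measurable N"
    and bnd: "AE x in S. g x \<in> {0..K}" and K: "0 < K" and t: "0 \<le> t"
  shows "measure M {\<omega> \<in> space M. \<bar>(\<Sum>i = 1..n. g (y i \<omega>)) / real n - (\<integral>x. g x \<partial>S)\<bar> \<ge> t}
    \<le> 2 * exp (- 2 * real n * t\<^sup>2 / K\<^sup>2)"
proof -
  interpret prob_space M by fact
  have y: "y i \<in> M \<rightarrow>\<^sub>M N" if "i \<in> {1..n}" for i
    using indep that unfolding indep_vars_def by auto
  \<comment> \<open>Sample 1 serves as the reference copy for the common distribution.\<close>
  have one: "1 \<in> {1..n}" using n by simp
  interpret Hoeffding_ineq_iid M "{1..n}" "\<lambda>i \<omega>. g (y i \<omega>)" "\<lambda>\<omega>. g (y 1 \<omega>)" 0 K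
    "expectation (\<lambda>\<omega>. g (y 1 \<omega>))"
  proof unfold_locales
    show "finite {1..n}" by simp
    show "indep_vars (\<lambda>_. borel) (\<lambda>i \<omega>. g (y i \<omega>)) {1..n}"
      using indep_vars_compose2[OF indep] g by simp
    show "random_variable borel (\<lambda>\<omega>. g (y 1 \<omega>))"
      using y[OF one] g by measurable
    show "AE x in M. g (y 1 x) \<in> {0..K}"
      using bnd unfolding ident[OF one, symmetric] by (rule AE_distrD[OF y[OF one]])
    fix i assume i: "i \<in> {1..n}"
    have "distr M borel (\<lambda>\<omega>. g (y j \<omega>)) = distr S borel g" if "j \<in> {1..n}" for j
      unfolding ident[OF that, symmetric]
      using distr_distr[OF g y[OF that]] by (simp add: comp_def)
    then show "distr M borel (\<lambda>\<omega>. g (y i \<omega>)) = distr M borel (\<lambda>\<omega>. g (y 1 \<omega>))"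
      using i one by simp
  qed simp_all
  have "expectation (\<lambda>\<omega>. g (y 1 \<omega>)) = (\<integral>x. g x \<partial>S)"
    unfolding ident[OF one, symmetric] by (rule integral_distr[symmetric, OF y[OF one] g])
  moreover have "{1..n} \<noteq> {}" using n by simp
  ultimately show ?thesis
    using Hoeffding_ineq_abs_ge'[OF t K]
    by (simp only: card_atLeastAtMost diff_Suc_1 diff_zero not_False_eq_True True_implies_equals)
qed

section \<open>Union bound over the net and passage to all of \<open>A\<close>\<close>

theorem theorem2p7:
  fixes Y :: "'a::euclidean_space set"
    and \<rho> :: "'a measure"
    and s :: "'a \<Rightarrow> 'v::banach \<Rightarrow> real"
    and w :: "'a \<Rightarrow> real"
    and M :: "'b measure"
    and y :: "nat \<Rightarrow> 'b \<Rightarrow> 'a"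
    and n :: nat
    and A :: "'v set"
    and K \<delta> :: real
  assumes Y_borel: "Y \<in> sets borel"
    and rho_prob: "prob_space \<rho>"
    and rho_sets: "sets \<rho> = sets (restrict_space borel Y)"
    and seminorm: "\<And>x. x \<in> Y \<Longrightarrow> is_seminorm (s x)"
    and s_meas: "\<And>v. (\<lambda>x. s x v) \<in> borel_measurable \<rho>"
    and s_int: "\<And>v. integrable \<rho> (\<lambda>x. (s x v)\<^sup>2)"
    and norm_eq: "\<And>v. norm v = sqrt (\<integral>x. (s x v)\<^sup>2 \<partial>\<rho>)"
    and w_meas: "w \<in> borel_measurable \<rho>"
    and w_nonneg: "\<And>x. x \<in> Y \<Longrightarrow> 0 \<le> w x"
    and w_int: "(\<integral>\<^sup>+ x. inverse (ennreal (w x)) \<partial>\<rho>) = 1"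
    and M_prob: "prob_space M"
    and n_pos: "1 \<le> n"
    and indep: "prob_space.indep_vars M (\<lambda>_. \<rho>) y {1..n}"
    and ident: "\<And>i. i \<in> {1..n} \<Longrightarrow> distr M \<rho> (y i) = sampling_measure \<rho> w"
    and emp_le: "AE \<omega> in M. \<forall>v. ereal (emp_norm w s n (\<lambda>i. y i \<omega>) v) \<le> wsup_norm \<rho> w s v"
    and A_nonzero: "A - {0} \<noteq> {}"
    and K: "variation_const \<rho> w s (normalized A) = ereal K"
    and delta_pos: "0 < \<delta>"
    and RIP_event: "{\<omega> \<in> space M. RIP w s n (\<lambda>i. y i \<omega>) A \<delta>} \<in> sets M"
  shows "ereal (measure M {\<omega> \<in> space M. RIP w s n (\<lambda>i. y i \<omega>) A \<delta>})
    \<ge> 1 - 2 * ereal_of_enat (covering_number (wsup_norm \<rho> w s) (normalized A) (1 / 4 * (\<delta> / sqrt K)))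
            * ereal (exp (- (real n / 2) * (\<delta> / K)\<^sup>2))"
proof -
  interpret \<rho>: prob_space \<rho> by fact
  interpret M: prob_space M by fact
  let ?U = "normalized A"
  let ?N = "wsup_norm \<rho> w s"
  let ?e = "1 / 4 * (\<delta> / sqrt K)"
  let ?E = "exp (- (real n / 2) * (\<delta> / K)\<^sup>2)"
  let ?R = "{\<omega> \<in> space M. RIP w s n (\<lambda>i. y i \<omega>) A \<delta>}"
  let ?emp = "\<lambda>\<omega>. emp_norm w s n (\<lambda>i. y i \<omega>)"
  have space: "space \<rho> = Y"
    using sets_eq_imp_space_eq[OF rho_sets] by (simp add: space_restrict_space)
  have w_pos: "AE x in \<rho>. 0 < w x"
    using w_int by (intro AE_weight_pos w_meas) simp
  have sq_le: "wsup_norm_sq \<rho> w s u \<le> ereal K" if "u \<in> ?U" for u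
    using SUP_upper[OF that, of "wsup_norm_sq \<rho> w s"] K by (simp only: variation_const_def)
  have AE_le: "AE x in \<rho>. w x * (s x u)\<^sup>2 \<in> {0..K}" if "u \<in> ?U" for u
  proof -
    have "AE x in \<rho>. ereal (w x * (s x u)\<^sup>2) \<le> wsup_norm_sq \<rho> w s u"
      unfolding wsup_norm_sq_def by (rule esssup_AE)
    with AE_space w_pos show ?thesis
    proof eventually_elim
      case (elim x)
      then have "ereal (w x * (s x u)\<^sup>2) \<le> ereal K"
        using sq_le[OF that] by order
      then show ?case using elim(2) by simp
    qed
  qed
  have int1: "(\<integral>x. (s x u)\<^sup>2 \<partial>\<rho>) = 1" if "u \<in> ?U" for u
    using norm_eq[of u] norm_normalized[OF that] by simp
  \<comment> \<open>Otherwise the squared seminorm of a unit vector would vanish almost everywhere,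
    as \<open>w\<close> is positive there. This makes the divisions by \<open>K\<close> and
    \<open>sqrt K\<close> meaningful.\<close>
  have K_pos: "0 < K"
  proof (rule ccontr)
    assume "\<not> 0 < K"
    obtain u where u: "u \<in> ?U" using A_nonzero by (auto simp: normalized_def)
    have "AE x in \<rho>. (s x u)\<^sup>2 = 0"
      using AE_le[OF u] w_pos
    proof eventually_elim
      case (elim x)
      then have "w x * (s x u)\<^sup>2 = 0" using \<open>\<not> 0 < K\<close> unfolding atLeastAtMost_iff by linarith
      with elim show ?case by simp
    qed
    then have "(\<integral>x. (s x u)\<^sup>2 \<partial>\<rho>) = 0" by (rule integral_eq_zero_AE)
    with int1[OF u] show False by simp
  qed
  have y_meas: "y i \<in> M \<rightarrow>\<^sub>M \<rho>" if "i \<in> {1..n}" for i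
    using indep that unfolding M.indep_vars_def by auto
  have yY: "y i \<omega> \<in> Y" if "i \<in> {1..n}" "\<omega> \<in> space M" for i \<omega>
    using measurable_space[OF y_meas[OF that(1)] that(2)] space by simp
  have semi: "is_seminorm (?emp \<omega>)" if "\<omega> \<in> space M" for \<omega>
    by (intro is_seminorm_emp_norm seminorm w_nonneg yY that)
  \<comment> \<open>The bad event at a centre uses up half of the tolerance; the other half is kept
    for moving from the centre to \<open>u\<close>.\<close>
  define D where "D c = {\<omega> \<in> space M.
      \<bar>(\<Sum>i = 1..n. w (y i \<omega>) * (s (y i \<omega>) c)\<^sup>2) / real n - 1\<bar> \<ge> \<delta> / 2}" for c
  have D_sets: "D c \<in> sets M" for c
  proof -
    have [measurable]: "(\<lambda>\<omega>. w (y i \<omega>) * (s (y i \<omega>) c)\<^sup>2) \<in> borel_measurable M"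
      if "i \<in> {1..n}" for i
      using measurable_compose[OF y_meas[OF that] w_meas]
        measurable_compose[OF y_meas[OF that] s_meas[of c]] by measurable
    show ?thesis unfolding D_def by measurable
  qed
  have D_prob: "measure M (D c) \<le> 2 * ?E" if c: "c \<in> ?U" for c
  proof -
    have g: "(\<lambda>x. w x * (s x c)\<^sup>2) \<in> borel_measurable \<rho>"
      using w_meas s_meas[of c] by measurable
    have bnd: "AE x in sampling_measure \<rho> w. w x * (s x c)\<^sup>2 \<in> {0..K}"
      unfolding sampling_measure_def
      by (subst AE_density) (use AE_le[OF c] w_meas in \<open>auto elim: eventually_mono\<close>)
    have "(\<integral>x. w x * (s x c)\<^sup>2 \<partial>sampling_measure \<rho> w) = 1"
      using integral_sampling_measure[OF w_meas w_pos, of "\<lambda>x. (s x c)\<^sup>2"] s_meas[of c] int1[OF c]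
      by simp
    \<comment> \<open>The Hoeffding exponent at deviation \<open>\<delta> / 2\<close>.\<close>
    moreover have "- 2 * real n * (\<delta> / 2)\<^sup>2 / K\<^sup>2 = - (real n / 2) * (\<delta> / K)\<^sup>2"
      by (simp add: power_divide field_simps)
    ultimately show ?thesis
      using Hoeffding_iid_sample[OF M_prob n_pos indep ident g bnd K_pos, of "\<delta> / 2"] delta_pos
      unfolding D_def by (simp only: half_gt_zero less_imp_le True_implies_equals)
  qed
  show ?thesis
  proof (cases "covering_number ?N ?U ?e")
    case infinity
    \<comment> \<open>The exponential factor is positive, so the lower bound is
      -\<infinity>.\<close>
    then show ?thesis by (simp add: one_ereal_def)
  next
    case (enat k)
    obtain C where C: "finite C" "C \<subseteq> ?U" "card C = k"
      and cover: "?U \<subseteq> (\<Union>c\<in>C. {v. ?N (v - c) < ereal ?e})"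
      by (rule covering_number_eqE[OF enat])
    \<comment> \<open>Failure of RIP forces a bad centre. The null set in \<open>emp_le\<close> is
      common to all vectors, so a single exceptional set serves the possibly uncountable family of
      \<open>u\<close>.\<close>
    have "AE \<omega> in M. \<omega> \<in> space M - ?R \<longrightarrow> \<omega> \<in> (\<Union>c\<in>C. D c)"
      using emp_le AE_space
    proof eventually_elim
      case (elim \<omega>)
      have "RIP w s n (\<lambda>i. y i \<omega>) A \<delta>" if nD: "\<omega> \<notin> (\<Union>c\<in>C. D c)"
      proof (rule RIP_normalizedI[OF semi[OF elim(2)]])
        fix u assume u: "u \<in> ?U"
        obtain c where c: "c \<in> C" and uc: "?N (u - c) < ereal ?e"
          using u cover by blast
        have bound: "?emp \<omega> v \<le> sqrt K" if "v \<in> ?U" for v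
        proof -
          have "ereal (?emp \<omega> v) \<le> ereal (sqrt K)"
            by (rule order_trans[OF spec[OF elim(1)] wsup_norm_le_sqrt[OF sq_le[OF that]]])
              (use K_pos in simp)
          then show ?thesis by simp
        qed
        have "ereal (?emp \<omega> (u - c)) \<le> ereal ?e"
          by (rule order_trans[OF spec[OF elim(1)] less_imp_le[OF uc]])
        then have e: "?emp \<omega> (u - c) \<le> ?e" by (simp only: ereal_less_eq)
        have c': "c \<in> ?U" using c C(2) by blast
        have "\<bar>(?emp \<omega> u)\<^sup>2 - (?emp \<omega> c)\<^sup>2\<bar> \<le> ?e * (2 * sqrt K)"
          by (rule is_seminorm_diff_sq_le[OF semi[OF elim(2)] bound[OF u] bound[OF c'] e])
        also have "\<dots> = \<delta> / 2" using K_pos by simp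
        finally have "\<bar>(?emp \<omega> u)\<^sup>2 - (?emp \<omega> c)\<^sup>2\<bar> \<le> \<delta> / 2" .
        moreover have "(?emp \<omega> c)\<^sup>2 = (\<Sum>i = 1..n. w (y i \<omega>) * (s (y i \<omega>) c)\<^sup>2) / real n"
          by (intro emp_norm_sq w_nonneg yY elim(2))
        \<comment> \<open>This is the complement of \<open>D c\<close>, with the sum read as the
          squared empirical norm.\<close>
        then have "\<bar>(?emp \<omega> c)\<^sup>2 - 1\<bar> < \<delta> / 2"
          using nD c elim(2) unfolding D_def by force
        ultimately show "\<bar>(?emp \<omega> u)\<^sup>2 - 1\<bar> \<le> \<delta>" by linarith
      qed
      then show ?case by blast
    qed
    \<comment> \<open>Inclusion up to a null set suffices for comparing the measures.\<close>
    then have "measure M (space M - ?R) \<le> measure M (\<Union>c\<in>C. D c)"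
      using D_sets C(1) by (intro M.finite_measure_mono_AE) auto
    also have "\<dots> \<le> (\<Sum>c\<in>C. measure M (D c))"
      using D_sets C(1) by (intro M.finite_measure_subadditive_finite) auto
    also have "\<dots> \<le> real k * (2 * ?E)"
      using sum_bounded_above[of C "\<lambda>c. measure M (D c)" "2 * ?E"] D_prob C by auto
    finally have "1 - 2 * real k * ?E \<le> measure M ?R"
      using M.prob_compl[OF RIP_event] by simp
    then show ?thesis
      unfolding enat by (simp only: ereal_of_enat_simps numeral_eq_ereal one_ereal_def times_ereal.simps
          ereal_minus ereal_less_eq)
  qed
qed

end
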